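(* Let $a>b$, $0<k<1$, $k'=\sqrt{1-k^2}$, and let $\delta,c_1,c_2\in\mathbb R$ be such that $\operatorname{cn}(\frac\delta2,k)>0$. For $n_1,n_2\in\frac12\mathbb Z$ with $\operatorname{cn}(\delta n_2+c_2,k)\ne0$ put $$x(n_1,n_2)=\frac{f_1(n_1)f_2(n_2)}{\sqrt{a-b}},\qquad y(n_1,n_2)=\frac{g_1(n_1)g_2(n_2)}{\sqrt{a-b}},$$ where $$f_1(n_1)=\hat\alpha_1\operatorname{sn}(\delta n_1+c_1,k),\quad g_1(n_1)=\hat\beta_1\operatorname{cn}(\delta n_1+c_1,k),\quad f_2(n_2)=\hat\alpha_2\frac{\operatorname{dn}(\delta n_2+c_2,k)}{\operatorname{cn}(\delta n_2+c_2,k)},\quad g_2(n_2)=\hat\beta_2\frac{1}{\operatorname{cn}(\delta n_2+c_2,k)},$$ $$\hat\alpha_1=\sqrt{(a-b)\frac{\operatorname{dn}(\frac\delta2,k)}{\operatorname{cn}(\frac\delta2,k)}},\quad\hat\beta_1=\sqrt{\frac{a-b}{\operatorname{cn}(\frac\delta2,k)}},\quad\hat\alpha_2=\frac1k\hat\alpha_1,\quad\hat\beta_2=\frac{k'}k\hat\beta_1.$$ Then for every constant $\xi$ the points $(x,y)$ with $n_1+n_2=\xi$ lie on a straight line, and for every constant $\eta$ the points $(x,y)$ with $n_1-n_2=\eta$ lie on a straight line. Moreover, all these lines are tangent to the ellipse $$\hat{\mathcal E}_0:\quad\frac{x^2}{\hat a_0}+\frac{y^2}{\hat b_0}=1,\qquad\hat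 a_0=(a-b)\frac1{k^2}\frac{\operatorname{dn}^2(\frac\delta2,k)}{\operatorname{cn}^2(\frac\delta2,k)},\quad\hat b_0=(a-b)\frac{(k')^2}{k^2}\frac1{\operatorname{cn}^2(\frac\delta2,k)}.$$ This ellipse belongs to the confocal family $\dfrac{x^2}{a+\lambda}+\dfrac{y^2}{b+\lambda}=1$, $\lambda\in\mathbb R$, since $\hat a_0-\hat b_0=a-b$.
   Context: $\operatorname{sn},\operatorname{cn},\operatorname{dn}$ are the Jacobi elliptic functions with modulus $k$. *)

theory Defs
  imports "HOL-Analysis.Analysis"
begin

text \<open>
  The Jacobi elliptic functions of a real argument \<open>u\<close> with modulus \<open>k\<close> (not parameter \<open>m = k\<^sup>2\<close>),
  obtained by inverting the incomplete elliptic integral of the first kind. The interval integral is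
  oriented, so the integral is also meaningful for negative amplitudes; for \<open>\<bar>k\<bar> < 1\<close> it is a
  bijection of the real line.
\<close>

definition ellF :: "real \<Rightarrow> real \<Rightarrow> real" where
  "ellF k \<phi> = (LBINT \<theta>=ereal 0..ereal \<phi>. 1 / sqrt (1 - k\<^sup>2 * (sin \<theta>)\<^sup>2))"

definition jacobi_am :: "real \<Rightarrow> real \<Rightarrow> real" where
  "jacobi_am u k = (THE \<phi>. ellF k \<phi> = u)"

definition jacobi_sn :: "real \<Rightarrow> real \<Rightarrow> real" where
  "jacobi_sn u k = sin (jacobi_am u k)"

definition jacobi_cn :: "real \<Rightarrow> real \<Rightarrow> real" where
  "jacobi_cn u k = cos (jacobi_am u k)"

definition jacobi_dn :: "real \<Rightarrow> real \<Rightarrow> real" where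
  "jacobi_dn u k = sqrt (1 - k\<^sup>2 * (jacobi_sn u k)\<^sup>2)"

definition straight_line :: "(real \<times> real) set \<Rightarrow> bool" where
  "straight_line L \<longleftrightarrow> affine L \<and> aff_dim L = 1"

text \<open>
  A line is tangent to a set \<open>C\<close> if it passes through a point \<open>\<gamma> 0\<close> of \<open>C\<close> in the direction of a
  nonzero velocity \<open>v\<close> of a path \<open>\<gamma>\<close> running inside \<open>C\<close>.
\<close>

definition tangent_line_to :: "(real \<times> real) set \<Rightarrow> (real \<times> real) set \<Rightarrow> bool" where
  "tangent_line_to L C \<longleftrightarrow> straight_line L \<and>
     (\<exists>(\<gamma> :: real \<Rightarrow> real \<times> real) v. (\<forall>t. \<gamma> t \<in> C) \<and> (\<gamma> has_vector_derivative v) (at 0) \<and> v \<noteq> 0 \<and>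
        \<gamma> 0 \<in> L \<and> \<gamma> 0 + v \<in> L)"

definition conic_curve :: "real \<Rightarrow> real \<Rightarrow> (real \<times> real) set" where
  "conic_curve A B = {(x, y). x\<^sup>2 / A + y\<^sup>2 / B = 1}"

text \<open>The nonvanishing conditions exclude values of \<open>\<lambda>\<close> for which the equation has no meaning.\<close>

definition confocal_family :: "real \<Rightarrow> real \<Rightarrow> (real \<times> real) set set" where
  "confocal_family a b = {conic_curve (a + l) (b + l) | l :: real. a + l \<noteq> 0 \<and> b + l \<noteq> 0}"

definition half_ints :: "real set" where
  "half_ints = range (\<lambda>m :: int. of_int m / 2)"

definition alpha1 :: "real \<Rightarrow> real \<Rightarrow> real \<Rightarrow> real \<Rightarrow> real" where
  "alpha1 a b k \<delta> = sqrt ((a - b) * (jacobi_dn (\<delta> / 2) k / jacobi_cn (\<delta> / 2) k))"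

definition beta1 :: "real \<Rightarrow> real \<Rightarrow> real \<Rightarrow> real \<Rightarrow> real" where
  "beta1 a b k \<delta> = sqrt ((a - b) / jacobi_cn (\<delta> / 2) k)"

definition alpha2 :: "real \<Rightarrow> real \<Rightarrow> real \<Rightarrow> real \<Rightarrow> real" where
  "alpha2 a b k \<delta> = 1 / k * alpha1 a b k \<delta>"

definition beta2 :: "real \<Rightarrow> real \<Rightarrow> real \<Rightarrow> real \<Rightarrow> real" where
  "beta2 a b k \<delta> = sqrt (1 - k\<^sup>2) / k * beta1 a b k \<delta>"

definition f1 :: "real \<Rightarrow> real \<Rightarrow> real \<Rightarrow> real \<Rightarrow> real \<Rightarrow> real \<Rightarrow> real" where
  "f1 a b k \<delta> c1 n1 = alpha1 a b k \<delta> * jacobi_sn (\<delta> * n1 + c1) k"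

definition g1 :: "real \<Rightarrow> real \<Rightarrow> real \<Rightarrow> real \<Rightarrow> real \<Rightarrow> real \<Rightarrow> real" where
  "g1 a b k \<delta> c1 n1 = beta1 a b k \<delta> * jacobi_cn (\<delta> * n1 + c1) k"

definition f2 :: "real \<Rightarrow> real \<Rightarrow> real \<Rightarrow> real \<Rightarrow> real \<Rightarrow> real \<Rightarrow> real" where
  "f2 a b k \<delta> c2 n2 =
     alpha2 a b k \<delta> * (jacobi_dn (\<delta> * n2 + c2) k / jacobi_cn (\<delta> * n2 + c2) k)"

definition g2 :: "real \<Rightarrow> real \<Rightarrow> real \<Rightarrow> real \<Rightarrow> real \<Rightarrow> real \<Rightarrow> real" where
  "g2 a b k \<delta> c2 n2 = beta2 a b k \<delta> * (1 / jacobi_cn (\<delta> * n2 + c2) k)"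

definition net_point ::
  "real \<Rightarrow> real \<Rightarrow> real \<Rightarrow> real \<Rightarrow> real \<Rightarrow> real \<Rightarrow> real \<Rightarrow> real \<Rightarrow> real \<times> real" where
  "net_point a b k \<delta> c1 c2 n1 n2 =
     (f1 a b k \<delta> c1 n1 * f2 a b k \<delta> c2 n2 / sqrt (a - b),
      g1 a b k \<delta> c1 n1 * g2 a b k \<delta> c2 n2 / sqrt (a - b))"

definition a0 :: "real \<Rightarrow> real \<Rightarrow> real \<Rightarrow> real \<Rightarrow> real" where
  "a0 a b k \<delta> = (a - b) * (1 / k\<^sup>2) * ((jacobi_dn (\<delta> / 2) k)\<^sup>2 / (jacobi_cn (\<delta> / 2) k)\<^sup>2)"

definition b0 :: "real \<Rightarrow> real \<Rightarrow> real \<Rightarrow> real \<Rightarrow> real" where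
  "b0 a b k \<delta> = (a - b) * ((sqrt (1 - k\<^sup>2))\<^sup>2 / k\<^sup>2) * (1 / (jacobi_cn (\<delta> / 2) k)\<^sup>2)"

end

theory Submission
  imports Defs
begin

text \<open>
  Put \<open>u = \<delta> n1 + c1\<close> and \<open>v = \<delta> n2 + c2\<close>. Dividing the coordinates of a net point by the
  semi-axes of the ellipse leaves \<open>X = sn u dn v / cn v\<close> and \<open>Y = cn u / cn v\<close>, and the ellipse
  becomes the unit circle. The addition theorem, in the form
  \<open>cn v = cn s cn u + sn s sn u dn v\<close> for \<open>s = u + v\<close>, says precisely that
  \<open>X sn s + Y cn s = 1\<close>. For constant \<open>n1 + n2\<close> the number \<open>s\<close> is constant, so this is the equation
  of a fixed line, and it is the tangent of the unit circle at \<open>(sn s, cn s)\<close>. Since \<open>cn\<close> and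
  \<open>dn\<close> are even, replacing \<open>v\<close> by \<open>- v\<close> leaves \<open>X\<close> and \<open>Y\<close> unchanged and gives the lines
  of constant \<open>n1 - n2\<close>.

  What has to be built is the addition theorem. The integrand of the elliptic integral is at least
  \<open>1\<close>, hence the integral is a bijection of the real line, the amplitude is its differentiable
  inverse, and \<open>sn\<close>, \<open>cn\<close>, \<open>dn\<close> satisfy their well-known differential equations
  (\<open>jacobi_sn_deriv\<close>, \<open>jacobi_cn_deriv\<close>, \<open>jacobi_dn_deriv\<close>). With these, the right-hand sides
  of the rational addition formulas, taken at \<open>u\<close> and \<open>s - u\<close>, have derivative zero in \<open>u\<close>, so
  they agree with their values at \<open>u = 0\<close>.
\<close>

section \<open>The amplitude as inverse of the elliptic integral\<close>

lemma modulus_sin_pos: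
  fixes k :: real
  assumes "\<bar>k\<bar> < 1"
  shows "1 - k\<^sup>2 * (sin t)\<^sup>2 > 0"
proof -
  have "k\<^sup>2 < 1" using assms by (simp add: abs_square_less_1)
  moreover have "(sin t)\<^sup>2 \<le> 1" by (simp add: abs_square_le_1)
  ultimately have "k\<^sup>2 * (sin t)\<^sup>2 < 1"
    by (smt (verit) mult_left_le zero_le_power2)
  thus ?thesis by simp
qed

lemma ellF_deriv:
  assumes k: "\<bar>k\<bar> < 1"
  shows "(ellF k has_real_derivative 1 / sqrt (1 - k\<^sup>2 * (sin x)\<^sup>2)) (at x)"
proof -
  let ?f = "\<lambda>t. 1 / sqrt (1 - k\<^sup>2 * (sin t)\<^sup>2)"
  let ?A = "- \<bar>x\<bar> - 1" and ?B = "\<bar>x\<bar> + 1"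
  have "continuous_on {?A..?B} ?f"
    using modulus_sin_pos[OF k] by (intro continuous_intros) (auto simp: less_imp_neq[symmetric])
  hence "((\<lambda>u. LBINT y=ereal 0..ereal u. ?f y) has_vector_derivative ?f x) (at x within {?A..?B})"
    by (intro interval_integral_FTC2) auto
  moreover have "at x within {?A..?B} = at x"
    by (rule at_within_Icc_at) auto
  ultimately show ?thesis
    by (simp add: ellF_def[abs_def] has_real_derivative_iff_has_vector_derivative)
qed

lemma ellF_0 [simp]: "ellF k 0 = 0"
  by (simp add: ellF_def)

lemma ellF_minus:
  assumes k: "\<bar>k\<bar> < 1"
  shows "ellF k (- x) = - ellF k x"
proof -
  have "((\<lambda>x. ellF k x + ellF k (- x)) has_real_derivative 0) (at y)" for y
    using DERIV_add[OF ellF_deriv[OF k, of y] DERIV_chain2[OF ellF_deriv[OF k], of uminus "- 1" y]]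
    by (simp add: DERIV_minus[OF DERIV_ident])
  hence "ellF k x + ellF k (- x) = ellF k 0 + ellF k (- 0)"
    by (intro DERIV_isconst_all) auto
  thus ?thesis by simp
qed

text \<open>The integrand is at least \<open>1\<close>, so the integral grows at least as fast as the identity; this
  gives injectivity and, with the intermediate value theorem, surjectivity.\<close>

lemma ellF_diff_ge:
  assumes k: "\<bar>k\<bar> < 1" and "x \<le> y"
  shows "y - x \<le> ellF k y - ellF k x"
proof -
  have "(\<lambda>t. ellF k t - t) x \<le> (\<lambda>t. ellF k t - t) y"
  proof (rule DERIV_nonneg_imp_nondecreasing[OF \<open>x \<le> y\<close>])
    fix t
    let ?m = "1 - k\<^sup>2 * (sin t)\<^sup>2"
    have "((\<lambda>t. ellF k t - t) has_real_derivative 1 / sqrt ?m - 1) (at t)"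
      by (intro derivative_intros ellF_deriv k)
    moreover have "1 / sqrt ?m - 1 \<ge> 0"
      using modulus_sin_pos[OF k, of t] by (simp add: field_simps)
    ultimately show "\<exists>d. ((\<lambda>t. ellF k t - t) has_real_derivative d) (at t) \<and> d \<ge> 0"
      by blast
  qed
  thus ?thesis by simp
qed

lemma ellF_isCont: "\<bar>k\<bar> < 1 \<Longrightarrow> isCont (ellF k) x"
  using ellF_deriv DERIV_isCont by blast

lemma ellF_surj:
  assumes k: "\<bar>k\<bar> < 1"
  shows "\<exists>\<phi>. ellF k \<phi> = u"
proof -
  have "ellF k (- \<bar>u\<bar>) \<le> u" "u \<le> ellF k \<bar>u\<bar>"
    using ellF_diff_ge[OF k, of "- \<bar>u\<bar>" 0] ellF_diff_ge[OF k, of 0 "\<bar>u\<bar>"] by auto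
  thus ?thesis
    using IVT[of "ellF k" "- \<bar>u\<bar>" u "\<bar>u\<bar>"] ellF_isCont[OF k] by auto
qed

lemma ellF_inj:
  assumes k: "\<bar>k\<bar> < 1" and "ellF k x = ellF k y"
  shows "x = y"
  using ellF_diff_ge[OF k, of x y] ellF_diff_ge[OF k, of y x] assms(2) by linarith

lemma jacobi_am_ellF:
  assumes k: "\<bar>k\<bar> < 1"
  shows "jacobi_am (ellF k \<phi>) k = \<phi>"
  unfolding jacobi_am_def using ellF_inj[OF k] by blast

lemma ellF_jacobi_am:
  assumes k: "\<bar>k\<bar> < 1"
  shows "ellF k (jacobi_am u k) = u"
  using ellF_surj[OF k, of u] jacobi_am_ellF[OF k] by metis

lemma jacobi_am_0: "\<bar>k\<bar> < 1 \<Longrightarrow> jacobi_am 0 k = 0"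
  using jacobi_am_ellF[of k 0] by simp

lemma jacobi_am_minus: "\<bar>k\<bar> < 1 \<Longrightarrow> jacobi_am (- u) k = - jacobi_am u k"
  by (metis ellF_minus ellF_jacobi_am jacobi_am_ellF)

lemma jacobi_am_deriv:
  assumes k: "\<bar>k\<bar> < 1"
  shows "((\<lambda>u. jacobi_am u k) has_real_derivative jacobi_dn u k) (at u)"
proof -
  let ?d = "jacobi_dn u k"
  have pos: "?d > 0"
    using modulus_sin_pos[OF k] by (simp add: jacobi_dn_def jacobi_sn_def)
  have cont: "isCont (\<lambda>u. jacobi_am u k) u"
  proof -
    have "isCont (\<lambda>u. jacobi_am u k) (ellF k (jacobi_am u k))"
      by (rule isCont_inverse_function[where d = 1])
         (auto simp: jacobi_am_ellF[OF k] ellF_isCont[OF k])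
    thus ?thesis by (simp add: ellF_jacobi_am[OF k])
  qed
  have "((\<lambda>u. jacobi_am u k) has_real_derivative inverse (1 / ?d)) (at u)"
  proof (rule DERIV_inverse_function[where a = "u - 1" and b = "u + 1"])
    show "(ellF k has_real_derivative 1 / ?d) (at (jacobi_am u k))"
      using ellF_deriv[OF k] by (simp add: jacobi_dn_def jacobi_sn_def)
  qed (use pos cont in \<open>auto simp: ellF_jacobi_am[OF k]\<close>)
  thus ?thesis by simp
qed

section \<open>Elementary properties of the Jacobi functions\<close>

lemma jacobi_cn_sn_squares: "(jacobi_cn u k)\<^sup>2 + (jacobi_sn u k)\<^sup>2 = 1"
  by (simp add: jacobi_cn_def jacobi_sn_def)

lemma jacobi_dn_pos: "\<bar>k\<bar> < 1 \<Longrightarrow> jacobi_dn u k > 0"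
  using modulus_sin_pos by (simp add: jacobi_dn_def jacobi_sn_def)

lemma jacobi_dn_sn_squares:
  assumes "\<bar>k\<bar> < 1"
  shows "(jacobi_dn u k)\<^sup>2 + k\<^sup>2 * (jacobi_sn u k)\<^sup>2 = 1"
  using modulus_sin_pos[OF assms, of "jacobi_am u k"] by (simp add: jacobi_dn_def jacobi_sn_def)

lemma jacobi_0:
  assumes "\<bar>k\<bar> < 1"
  shows "jacobi_sn 0 k = 0" "jacobi_cn 0 k = 1" "jacobi_dn 0 k = 1"
  using assms by (simp_all add: jacobi_sn_def jacobi_cn_def jacobi_dn_def jacobi_am_0)

lemma jacobi_minus:
  assumes "\<bar>k\<bar> < 1"
  shows "jacobi_cn (- u) k = jacobi_cn u k" "jacobi_dn (- u) k = jacobi_dn u k"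
  using assms by (simp_all add: jacobi_sn_def jacobi_cn_def jacobi_dn_def jacobi_am_minus)

lemma jacobi_sn_deriv:
  assumes "\<bar>k\<bar> < 1"
  shows "((\<lambda>u. jacobi_sn u k) has_real_derivative jacobi_cn u k * jacobi_dn u k) (at u)"
  unfolding jacobi_sn_def jacobi_cn_def
  by (auto intro!: derivative_eq_intros jacobi_am_deriv[OF assms])

lemma jacobi_cn_deriv:
  assumes "\<bar>k\<bar> < 1"
  shows "((\<lambda>u. jacobi_cn u k) has_real_derivative - (jacobi_sn u k * jacobi_dn u k)) (at u)"
  unfolding jacobi_sn_def jacobi_cn_def
  by (auto intro!: derivative_eq_intros jacobi_am_deriv[OF assms])

lemma jacobi_dn_deriv:
  assumes k: "\<bar>k\<bar> < 1"
  shows "((\<lambda>u. jacobi_dn u k) has_real_derivative - (k\<^sup>2 * jacobi_sn u k * jacobi_cn u k)) (at u)"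
proof -
  have pos: "1 - k\<^sup>2 * (jacobi_sn u k)\<^sup>2 > 0"
    using modulus_sin_pos[OF k] by (simp add: jacobi_sn_def)
  have "((\<lambda>u. sqrt (1 - k\<^sup>2 * (jacobi_sn u k)\<^sup>2)) has_real_derivative
      (- (k\<^sup>2 * (2 * jacobi_sn u k * (jacobi_cn u k * jacobi_dn u k))))
        * (inverse (jacobi_dn u k) / 2)) (at u)"
    unfolding jacobi_dn_def[of u]
    using pos
    by (auto intro!: derivative_eq_intros jacobi_sn_deriv[OF k] simp: jacobi_dn_def field_simps)
  also have "(- (k\<^sup>2 * (2 * jacobi_sn u k * (jacobi_cn u k * jacobi_dn u k))))
        * (inverse (jacobi_dn u k) / 2) = - (k\<^sup>2 * jacobi_sn u k * jacobi_cn u k)"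
    using jacobi_dn_pos[OF k, of u] by (simp add: field_simps)
  finally show ?thesis by (simp add: jacobi_dn_def[abs_def])
qed

section \<open>The addition theorem\<close>

text \<open>The number \<open>k sn u\<close> is again a modulus, so this is the positivity of a radicand of the
  elliptic integral.\<close>

lemma addition_denominator_pos:
  assumes k: "\<bar>k\<bar> < 1"
  shows "1 - k\<^sup>2 * (jacobi_sn u k)\<^sup>2 * (jacobi_sn v k)\<^sup>2 > 0"
proof -
  have "\<bar>k * jacobi_sn u k\<bar> < 1"
    using k mult_left_le[of "\<bar>jacobi_sn u k\<bar>" "\<bar>k\<bar>"]
    by (simp add: jacobi_sn_def abs_mult)
  from modulus_sin_pos[OF this, of "jacobi_am v k"] show ?thesis
    by (simp add: jacobi_sn_def power_mult_distrib)
qed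

text \<open>With the sum \<open>w = u + v\<close> held fixed, the quotients \<open>N t / \<Delta> t\<close> and \<open>M t / \<Delta> t\<close> of the addition
  formulas for the arguments \<open>t\<close> and \<open>w - t\<close> are constant in \<open>t\<close>, and at \<open>t = 0\<close> they are
  \<open>sn w\<close> and \<open>cn w\<close>.\<close>

lemma jacobi_addition:
  assumes k: "\<bar>k\<bar> < 1"
  defines "s \<equiv> \<lambda>u. jacobi_sn u k" and "c \<equiv> \<lambda>u. jacobi_cn u k" and "d \<equiv> \<lambda>u. jacobi_dn u k"
  shows jacobi_sn_add:
      "s (u + v) * (1 - k\<^sup>2 * (s u)\<^sup>2 * (s v)\<^sup>2) = s u * c v * d v + s v * c u * d u"
    and jacobi_cn_add:
      "c (u + v) * (1 - k\<^sup>2 * (s u)\<^sup>2 * (s v)\<^sup>2) = c u * c v - s u * s v * d u * d v"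
proof -
  define w where "w = u + v"
  define \<Delta> where "\<Delta> = (\<lambda>t. 1 - k\<^sup>2 * (s t)\<^sup>2 * (s (w - t))\<^sup>2)"
  define N where "N = (\<lambda>t. s t * c (w - t) * d (w - t) + s (w - t) * c t * d t)"
  define M where "M = (\<lambda>t. c t * c (w - t) - s t * s (w - t) * d t * d (w - t))"
  have cs: "(c t)\<^sup>2 + (s t)\<^sup>2 = 1" and ds: "(d t)\<^sup>2 + k\<^sup>2 * (s t)\<^sup>2 = 1" for t
    using jacobi_cn_sn_squares jacobi_dn_sn_squares[OF k] by (simp_all add: s_def c_def d_def)
  have \<Delta>_nz: "\<Delta> t \<noteq> 0" for t
    using addition_denominator_pos[OF k, of t "w - t"] by (simp add: \<Delta>_def s_def)
  have D: "(s has_real_derivative c t * d t) (at t)"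
      "(c has_real_derivative - (s t * d t)) (at t)"
      "(d has_real_derivative - (k\<^sup>2 * s t * c t)) (at t)" for t
    using jacobi_sn_deriv[OF k] jacobi_cn_deriv[OF k] jacobi_dn_deriv[OF k]
    by (simp_all add: s_def c_def d_def)
  have reflect: "((\<lambda>t. f (w - t)) has_real_derivative - f') (at t)"
    if "(f has_real_derivative f') (at (w - t))" for f :: "real \<Rightarrow> real" and f' t
  proof -
    have "((\<lambda>t. w - t) has_real_derivative - 1) (at t)"
      by (auto intro!: derivative_eq_intros)
    from DERIV_chain2[where g = "\<lambda>t. w - t", OF that this] show ?thesis by simp
  qed
  have R: "((\<lambda>t. s (w - t)) has_real_derivative - (c (w - t) * d (w - t))) (at t)"
      "((\<lambda>t. c (w - t)) has_real_derivative s (w - t) * d (w - t)) (at t)"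
      "((\<lambda>t. d (w - t)) has_real_derivative k\<^sup>2 * s (w - t) * c (w - t)) (at t)" for t
    using reflect D by fastforce+
  define \<Delta>' where "\<Delta>' = (\<lambda>t. - 2 * k\<^sup>2 * s t * s (w - t) *
      (c t * d t * s (w - t) - s t * c (w - t) * d (w - t)))"
  define N' where "N' = (\<lambda>t. s t * s (w - t) *
      ((d (w - t))\<^sup>2 - (d t)\<^sup>2 + k\<^sup>2 * ((c (w - t))\<^sup>2 - (c t)\<^sup>2)))"
  define M' where "M' = (\<lambda>t. c t * s (w - t) * d (w - t) - s t * c (w - t) * d t
      + d t * s t * c (w - t) * ((d (w - t))\<^sup>2 - k\<^sup>2 * (s (w - t))\<^sup>2)
      - d (w - t) * s (w - t) * c t * ((d t)\<^sup>2 - k\<^sup>2 * (s t)\<^sup>2))"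
  have d\<Delta>: "(\<Delta> has_real_derivative \<Delta>' t) (at t)" for t
    unfolding \<Delta>_def \<Delta>'_def by (auto intro!: derivative_eq_intros D R simp: algebra_simps power2_eq_square)
  have dN: "(N has_real_derivative N' t) (at t)" for t
    unfolding N_def N'_def by (auto intro!: derivative_eq_intros D R simp: algebra_simps power2_eq_square)
  have dM: "(M has_real_derivative M' t) (at t)" for t
    unfolding M_def M'_def by (auto intro!: derivative_eq_intros D R simp: algebra_simps power2_eq_square)
  \<comment> \<open>The numerators of the quotient rule are polynomials in the six functions; they vanish modulo
    the two quadratic relations \<open>cs\<close> and \<open>ds\<close>.\<close>
  have N0: "N' t * \<Delta> t - N t * \<Delta>' t = 0" for t
    using cs[of t] cs[of "w - t"] ds[of t] ds[of "w - t"]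
    unfolding N'_def N_def \<Delta>_def \<Delta>'_def by algebra
  have M0: "M' t * \<Delta> t - M t * \<Delta>' t = 0" for t
    using cs[of t] cs[of "w - t"] ds[of t] ds[of "w - t"]
    unfolding M'_def M_def \<Delta>_def \<Delta>'_def by algebra
  have "((\<lambda>t. N t / \<Delta> t) has_real_derivative (N' t * \<Delta> t - N t * \<Delta>' t) / (\<Delta> t * \<Delta> t)) (at t)" for t
    by (intro DERIV_divide dN d\<Delta> \<Delta>_nz)
  hence "N u / \<Delta> u = N 0 / \<Delta> 0"
    using N0 by (intro DERIV_isconst_all) auto
  also have "\<dots> = s w"
    using jacobi_0[OF k] by (simp add: N_def \<Delta>_def s_def c_def d_def)
  finally show "s (u + v) * (1 - k\<^sup>2 * (s u)\<^sup>2 * (s v)\<^sup>2) = s u * c v * d v + s v * c u * d u"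
    using \<Delta>_nz[of u] by (simp add: field_simps N_def \<Delta>_def w_def)
  have "((\<lambda>t. M t / \<Delta> t) has_real_derivative (M' t * \<Delta> t - M t * \<Delta>' t) / (\<Delta> t * \<Delta> t)) (at t)" for t
    by (intro DERIV_divide dM d\<Delta> \<Delta>_nz)
  hence "M u / \<Delta> u = M 0 / \<Delta> 0"
    using M0 by (intro DERIV_isconst_all) auto
  also have "\<dots> = c w"
    using jacobi_0[OF k] by (simp add: M_def \<Delta>_def s_def c_def d_def)
  finally show "c (u + v) * (1 - k\<^sup>2 * (s u)\<^sup>2 * (s v)\<^sup>2) = c u * c v - s u * s v * d u * d v"
    using \<Delta>_nz[of u] by (simp add: field_simps M_def \<Delta>_def w_def)
qed

text \<open>The spherical law of cosines for a triangle with sides \<open>am u\<close>, \<open>am v\<close>, \<open>am (u + v)\<close>: the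
  factor \<open>dn v\<close> is the cosine of the angle opposite to \<open>am v\<close>. After multiplication by the
  denominator of the rational addition formulas it becomes a polynomial identity.\<close>

lemma jacobi_cn_spherical:
  assumes k: "\<bar>k\<bar> < 1"
  shows "jacobi_cn v k = jacobi_sn (u + v) k * jacobi_sn u k * jacobi_dn v k
                       + jacobi_cn (u + v) k * jacobi_cn u k"
proof -
  let ?\<Delta> = "1 - k\<^sup>2 * (jacobi_sn u k)\<^sup>2 * (jacobi_sn v k)\<^sup>2"
  have "jacobi_cn v k * ?\<Delta> = (jacobi_sn (u + v) k * jacobi_sn u k * jacobi_dn v k
                       + jacobi_cn (u + v) k * jacobi_cn u k) * ?\<Delta>"
    using jacobi_sn_add[OF k, of u v] jacobi_cn_add[OF k, of u v]
      jacobi_cn_sn_squares[of u k] jacobi_dn_sn_squares[OF k, of v]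
    by algebra
  thus ?thesis
    using addition_denominator_pos[OF k, of u v] by simp
qed

section \<open>Tangent lines of an ellipse\<close>

text \<open>The tangent at \<open>(p sin \<phi>, q cos \<phi>)\<close>. Measuring the eccentric angle from the \<open>y\<close>-axis makes
  \<open>\<phi> = am s\<close> the parameter of the point \<open>(p sn s, q cn s)\<close>.\<close>

definition ellipse_tangent :: "real \<Rightarrow> real \<Rightarrow> real \<Rightarrow> (real \<times> real) set" where
  "ellipse_tangent p q \<phi> = {(x, y). x / p * sin \<phi> + y / q * cos \<phi> = 1}"

lemma straight_line_ellipse_tangent:
  assumes "p \<noteq> 0" "q \<noteq> 0"
  shows "straight_line (ellipse_tangent p q \<phi>)"
proof -
  define n where "n = (sin \<phi> / p, cos \<phi> / q)"
  have eq: "ellipse_tangent p q \<phi> = {z. n \<bullet> z = 1}"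
    by (auto simp: ellipse_tangent_def n_def inner_prod_def field_simps)
  have "n \<noteq> 0"
    using assms sin_zero_norm_cos_one[of \<phi>] by (auto simp: n_def zero_prod_def)
  thus ?thesis
    unfolding straight_line_def eq by (simp add: affine_hyperplane aff_dim_hyperplane)
qed

lemma ellipse_tangent_is_tangent:
  assumes "p \<noteq> 0" "q \<noteq> 0"
  shows "tangent_line_to (ellipse_tangent p q \<phi>) (conic_curve (p\<^sup>2) (q\<^sup>2))"
proof -
  define \<gamma> where "\<gamma> = (\<lambda>t. (p * sin (\<phi> + t), q * cos (\<phi> + t)))"
  define v where "v = (p * cos \<phi>, - q * sin \<phi>)"
  have "\<gamma> t \<in> conic_curve (p\<^sup>2) (q\<^sup>2)" for t
    using assms by (simp add: \<gamma>_def conic_curve_def power_mult_distrib)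
  moreover have "(\<gamma> has_vector_derivative v) (at 0)"
    unfolding \<gamma>_def v_def
    by (intro has_vector_derivative_Pair)
       (auto intro!: derivative_eq_intros simp: has_real_derivative_iff_has_vector_derivative[symmetric])
  moreover have "v \<noteq> 0"
    using assms sin_zero_norm_cos_one[of \<phi>] by (auto simp: v_def zero_prod_def)
  moreover have "\<gamma> 0 \<in> ellipse_tangent p q \<phi>" "\<gamma> 0 + v \<in> ellipse_tangent p q \<phi>"
  proof -
    have sq: "sin \<phi> * sin \<phi> + cos \<phi> * cos \<phi> = 1"
      using sin_cos_squared_add[of \<phi>] by (simp add: power2_eq_square)
    thus "\<gamma> 0 \<in> ellipse_tangent p q \<phi>"
      using assms by (simp add: \<gamma>_def ellipse_tangent_def)
    have "(sin \<phi> + cos \<phi>) * sin \<phi> + (cos \<phi> - sin \<phi>) * cos \<phi> = 1"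
      using sq by (simp add: algebra_simps)
    moreover have "\<gamma> 0 + v = (p * (sin \<phi> + cos \<phi>), q * (cos \<phi> - sin \<phi>))"
      by (simp add: \<gamma>_def v_def algebra_simps)
    ultimately show "\<gamma> 0 + v \<in> ellipse_tangent p q \<phi>"
      using assms by (simp add: ellipse_tangent_def)
  qed
  ultimately show ?thesis
    using straight_line_ellipse_tangent[OF assms] unfolding tangent_line_to_def by blast
qed

section \<open>The net in coordinates scaled by the semi-axes\<close>

definition semi_axis_x :: "real \<Rightarrow> real \<Rightarrow> real \<Rightarrow> real \<Rightarrow> real" where
  "semi_axis_x a b k \<delta> = sqrt (a - b) * jacobi_dn (\<delta> / 2) k / (k * jacobi_cn (\<delta> / 2) k)"

definition semi_axis_y :: "real \<Rightarrow> real \<Rightarrow> real \<Rightarrow> real \<Rightarrow> real" where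
  "semi_axis_y a b k \<delta> = sqrt (a - b) * sqrt (1 - k\<^sup>2) / (k * jacobi_cn (\<delta> / 2) k)"

context
  fixes a b k \<delta> :: real
  assumes ab: "a > b" and k0: "0 < k" and k1: "k < 1" and cn_pos: "jacobi_cn (\<delta> / 2) k > 0"
begin

lemma abs_k: "\<bar>k\<bar> < 1"
  using k0 k1 by simp

lemma k2_less: "k\<^sup>2 < 1"
  using k0 k1 by (simp add: power_less_one_iff)

lemma semi_axes_pos: "semi_axis_x a b k \<delta> > 0" "semi_axis_y a b k \<delta> > 0"
  using ab k0 k2_less cn_pos jacobi_dn_pos[OF abs_k, of "\<delta> / 2"]
  by (simp_all add: semi_axis_x_def semi_axis_y_def)

lemma a0_eq: "a0 a b k \<delta> = (semi_axis_x a b k \<delta>)\<^sup>2"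
  and b0_eq: "b0 a b k \<delta> = (semi_axis_y a b k \<delta>)\<^sup>2"
  using ab
  by (simp_all add: a0_def b0_def semi_axis_x_def semi_axis_y_def power_mult_distrib power_divide)

lemma net_point_eq:
  "net_point a b k \<delta> c1 c2 n1 n2 =
     (semi_axis_x a b k \<delta> * (jacobi_sn (\<delta> * n1 + c1) k *
        jacobi_dn (\<delta> * n2 + c2) k / jacobi_cn (\<delta> * n2 + c2) k),
      semi_axis_y a b k \<delta> * (jacobi_cn (\<delta> * n1 + c1) k / jacobi_cn (\<delta> * n2 + c2) k))"
proof -
  let ?D = "jacobi_dn (\<delta> / 2) k" and ?C = "jacobi_cn (\<delta> / 2) k"
  have root: "(a - b) / sqrt (a - b) = sqrt (a - b)"
    using ab by (simp add: real_div_sqrt)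
  have "alpha1 a b k \<delta> * alpha1 a b k \<delta> = (a - b) * (?D / ?C)"
    using ab cn_pos jacobi_dn_pos[OF abs_k, of "\<delta> / 2"] by (simp add: alpha1_def)
  hence "alpha1 a b k \<delta> * alpha2 a b k \<delta> / sqrt (a - b)
      = (a - b) / sqrt (a - b) * (?D / (k * ?C))"
    by (simp add: alpha2_def)
  hence A: "alpha1 a b k \<delta> * alpha2 a b k \<delta> / sqrt (a - b) = semi_axis_x a b k \<delta>"
    by (simp only: root) (simp add: semi_axis_x_def)
  have "beta1 a b k \<delta> * beta1 a b k \<delta> = (a - b) / ?C"
    using ab cn_pos by (simp add: beta1_def)
  moreover have "beta1 a b k \<delta> * beta2 a b k \<delta> / sqrt (a - b)
      = (beta1 a b k \<delta> * beta1 a b k \<delta>) * (sqrt (1 - k\<^sup>2) / k) / sqrt (a - b)"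
    by (simp add: beta2_def)
  ultimately have "beta1 a b k \<delta> * beta2 a b k \<delta> / sqrt (a - b)
      = (a - b) / sqrt (a - b) * (sqrt (1 - k\<^sup>2) / (k * ?C))"
    by (simp add: ac_simps)
  hence B: "beta1 a b k \<delta> * beta2 a b k \<delta> / sqrt (a - b) = semi_axis_y a b k \<delta>"
    by (simp only: root) (simp add: semi_axis_y_def)
  show ?thesis
    unfolding net_point_def f1_def f2_def g1_def g2_def A[symmetric] B[symmetric]
    by (simp add: ac_simps)
qed

text \<open>The difference case is the sum case for \<open>- v\<close> in place of \<open>v\<close>, because only the even functions
  \<open>cn v\<close> and \<open>dn v\<close> enter.\<close>

lemma net_point_on_tangent:
  assumes nz: "jacobi_cn (\<delta> * n2 + c2) k \<noteq> 0"
    and w: "w = (\<delta> * n1 + c1) + (\<delta> * n2 + c2) \<or> w = (\<delta> * n1 + c1) - (\<delta> * n2 + c2)"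
  shows "net_point a b k \<delta> c1 c2 n1 n2 \<in>
    ellipse_tangent (semi_axis_x a b k \<delta>) (semi_axis_y a b k \<delta>) (jacobi_am w k)"
proof -
  let ?u = "\<delta> * n1 + c1" and ?v = "\<delta> * n2 + c2"
  have "jacobi_cn ?v k = jacobi_sn w k * jacobi_sn ?u k * jacobi_dn ?v k
      + jacobi_cn w k * jacobi_cn ?u k"
    using w jacobi_cn_spherical[OF abs_k, of ?v ?u] jacobi_cn_spherical[OF abs_k, of "- ?v" ?u]
      jacobi_minus[OF abs_k, of ?v]
    by (metis diff_conv_add_uminus)
  hence "jacobi_sn ?u k * jacobi_dn ?v k / jacobi_cn ?v k * jacobi_sn w k
      + jacobi_cn ?u k / jacobi_cn ?v k * jacobi_cn w k = 1"
    using nz by (simp add: divide_simps ac_simps)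
  thus ?thesis
    using semi_axes_pos
    unfolding net_point_eq ellipse_tangent_def jacobi_sn_def[of w] jacobi_cn_def[of w] by simp
qed

lemma a0_minus_b0: "a0 a b k \<delta> - b0 a b k \<delta> = a - b"
proof -
  let ?D = "jacobi_dn (\<delta> / 2) k" and ?C = "jacobi_cn (\<delta> / 2) k"
  have "a0 a b k \<delta> - b0 a b k \<delta> = (a - b) * (?D\<^sup>2 - (1 - k\<^sup>2)) / (k\<^sup>2 * ?C\<^sup>2)"
    using k0 k2_less cn_pos by (simp add: a0_def b0_def field_simps)
  also have "?D\<^sup>2 - (1 - k\<^sup>2) = k\<^sup>2 * ?C\<^sup>2"
    using jacobi_cn_sn_squares[of "\<delta> / 2" k] jacobi_dn_sn_squares[OF abs_k, of "\<delta> / 2"] by algebra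
  finally show ?thesis using k0 cn_pos by simp
qed

end

theorem proposition8p2:
  fixes a b k \<delta> c1 c2 :: real
  assumes "a > b" and "0 < k" and "k < 1"
    and "jacobi_cn (\<delta> / 2) k > 0"
  shows "(\<forall>\<xi>::real. \<exists>L. straight_line L \<and>
            (\<forall>n1\<in>half_ints. \<forall>n2\<in>half_ints. jacobi_cn (\<delta> * n2 + c2) k \<noteq> 0 \<longrightarrow> n1 + n2 = \<xi> \<longrightarrow>
               net_point a b k \<delta> c1 c2 n1 n2 \<in> L) \<and>
            tangent_line_to L (conic_curve (a0 a b k \<delta>) (b0 a b k \<delta>)))
       \<and> (\<forall>\<eta>::real. \<exists>L. straight_line L \<and>
            (\<forall>n1\<in>half_ints. \<forall>n2\<in>half_ints. jacobi_cn (\<delta> * n2 + c2) k \<noteq> 0 \<longrightarrow> n1 - n2 = \<eta> \<longrightarrow>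
               net_point a b k \<delta> c1 c2 n1 n2 \<in> L) \<and>
            tangent_line_to L (conic_curve (a0 a b k \<delta>) (b0 a b k \<delta>)))
       \<and> a0 a b k \<delta> > 0 \<and> b0 a b k \<delta> > 0
       \<and> a0 a b k \<delta> - b0 a b k \<delta> = a - b
       \<and> conic_curve (a0 a b k \<delta>) (b0 a b k \<delta>) \<in> confocal_family a b"
proof (intro conjI allI)
  note tangent = straight_line_ellipse_tangent ellipse_tangent_is_tangent
  have ax: "semi_axis_x a b k \<delta> \<noteq> 0" "semi_axis_y a b k \<delta> \<noteq> 0"
    using semi_axes_pos[OF assms] by simp_all
  let ?L = "\<lambda>w. ellipse_tangent (semi_axis_x a b k \<delta>) (semi_axis_y a b k \<delta>) (jacobi_am w k)"
  show "\<exists>L. straight_line L \<and>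
      (\<forall>n1\<in>half_ints. \<forall>n2\<in>half_ints. jacobi_cn (\<delta> * n2 + c2) k \<noteq> 0 \<longrightarrow> n1 + n2 = \<xi> \<longrightarrow>
         net_point a b k \<delta> c1 c2 n1 n2 \<in> L) \<and>
      tangent_line_to L (conic_curve (a0 a b k \<delta>) (b0 a b k \<delta>))" for \<xi>
    using tangent[OF ax]
    by (intro exI[of _ "?L (\<delta> * \<xi> + (c1 + c2))"])
       (auto simp: a0_eq[OF assms] b0_eq[OF assms] algebra_simps
         intro!: net_point_on_tangent[OF assms])
  show "\<exists>L. straight_line L \<and>
      (\<forall>n1\<in>half_ints. \<forall>n2\<in>half_ints. jacobi_cn (\<delta> * n2 + c2) k \<noteq> 0 \<longrightarrow> n1 - n2 = \<eta> \<longrightarrow>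
         net_point a b k \<delta> c1 c2 n1 n2 \<in> L) \<and>
      tangent_line_to L (conic_curve (a0 a b k \<delta>) (b0 a b k \<delta>))" for \<eta>
    using tangent[OF ax]
    by (intro exI[of _ "?L (\<delta> * \<eta> + (c1 - c2))"])
       (auto simp: a0_eq[OF assms] b0_eq[OF assms] algebra_simps
         intro!: net_point_on_tangent[OF assms])
  show "a0 a b k \<delta> > 0" "b0 a b k \<delta> > 0"
    using ax by (simp_all add: a0_eq[OF assms] b0_eq[OF assms])
  show diff: "a0 a b k \<delta> - b0 a b k \<delta> = a - b"
    by (rule a0_minus_b0[OF assms])
  \<comment> \<open>The member of the family is the one with \<open>\<lambda> = a0 - a = b0 - b\<close>.\<close>
  have "a0 a b k \<delta> = a + (a0 a b k \<delta> - a)" "b0 a b k \<delta> = b + (a0 a b k \<delta> - a)"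
    using diff by simp_all
  thus "conic_curve (a0 a b k \<delta>) (b0 a b k \<delta>) \<in> confocal_family a b"
    unfolding confocal_family_def
    using \<open>a0 a b k \<delta> > 0\<close> \<open>b0 a b k \<delta> > 0\<close> by (smt (verit) mem_Collect_eq)
qed

end
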